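(* Let $N\ge392$ be an integer and $r>0$. For each $(i,j,\ell,m)\in\mathcal{C}_N$ with $i+j+\ell+m=0$ there exists $k\in\mathbb{Z}^2_{0,N}$ such that $$\mathbb{D}^k_i+\mathbb{D}^k_j+\mathbb{D}^k_\ell+\mathbb{D}^k_m\ne0.$$
   Context: $\mathbb{Z}^2_{0,N}=\{k\in\mathbb{Z}^2\setminus\{0\}:\max(|k_1|,|k_2|)\le N\}$; $|k|_r^2=k_1^2+r^2k_2^2$, $\langle j^\perp,k\rangle_r=r(j_2k_1-j_1k_2)$, and $c_{j,k}=\langle j^\perp,k\rangle_r\big(|k|_r^{-2}-|j|_r^{-2}\big)$ for $j,k\in\mathbb{Z}^2\setminus\{0\}$. For $i,k\in\mathbb{Z}^2_{0,N}$, $$\mathbb{D}^k_i=c_{i,k}\,c_{i+k,k}\,\mathbf{1}_{\mathbb{Z}^2_{0,N}}(i+k)-c_{i,k}\,c_{i-k,k}\,\mathbf{1}_{\mathbb{Z}^2_{0,N}}(i-k),$$ where a term is $0$ whenever its indicator vanishes. $\mathcal{C}_N=\{(i,j,\ell,m)\in(\mathbb{Z}^2_{0,N})^4:(i+j,\ell+m)\ne(0,0),\ (i+\ell,j+m)\ne(0,0),\ (i+m,j+\ell)\neq(0,0)\}$. *)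

theory Defs
  imports Complex_Main "HOL-Library.Product_Plus"
begin

definition lattice_box :: "int \<Rightarrow> (int \<times> int) set" where
  "lattice_box N = {k. k \<noteq> 0 \<and> max \<bar>fst k\<bar> \<bar>snd k\<bar> \<le> N}"

text \<open>The square of the anisotropic norm, \<open>|k|\<^sub>r\<^sup>2\<close>.\<close>

definition rnorm_sq :: "real \<Rightarrow> int \<times> int \<Rightarrow> real" where
  "rnorm_sq r k = (of_int (fst k))\<^sup>2 + r\<^sup>2 * (of_int (snd k))\<^sup>2"

text \<open>The pairing \<open>\<langle>j\<^sup>\<bottom>, k\<rangle>\<^sub>r\<close>, with \<open>j\<close> the rotated argument.\<close>

definition rperp :: "real \<Rightarrow> int \<times> int \<Rightarrow> int \<times> int \<Rightarrow> real" where
  "rperp r j k = r * of_int (snd j * fst k - fst j * snd k)"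

text \<open>Intended for nonzero \<open>j\<close> and \<open>k\<close> only; for a zero argument the value is junk (division by zero).\<close>

definition coef :: "real \<Rightarrow> int \<times> int \<Rightarrow> int \<times> int \<Rightarrow> real" where
  "coef r j k = rperp r j k * (1 / rnorm_sq r k - 1 / rnorm_sq r j)"

definition DD :: "real \<Rightarrow> int \<Rightarrow> int \<times> int \<Rightarrow> int \<times> int \<Rightarrow> real" where
  "DD r N k i =
     (if i + k \<in> lattice_box N then coef r i k * coef r (i + k) k else 0)
   - (if i - k \<in> lattice_box N then coef r i k * coef r (i - k) k else 0)"

text \<open>Each condition excludes only the simultaneous vanishing of both sums in a pairing.\<close>

definition CC :: "int \<Rightarrow> ((int \<times> int) \<times> (int \<times> int) \<times> (int \<times> int) \<times> (int \<times> int)) set" where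
  "CC N = {(i, j, l, m).
     i \<in> lattice_box N \<and> j \<in> lattice_box N \<and> l \<in> lattice_box N \<and> m \<in> lattice_box N \<and>
     (i + j, l + m) \<noteq> (0, 0) \<and> (i + l, j + m) \<noteq> (0, 0) \<and> (i + m, j + l) \<noteq> (0, 0)}"

end

theory Submission
  imports Defs "HOL-Computational_Algebra.Polynomial"
begin

text \<open>
  For \<open>k\<close> with \<open>k \<plusminus> v\<close> both in the box, \<open>\<D>\<^sup>k\<^sub>v\<close> is a rational function of \<open>k\<close> whose denominator
  contains the factors \<open>|k - v|\<^sub>r\<^sup>2\<close> and \<open>|k + v|\<^sub>r\<^sup>2\<close>. Once \<open>k\<close> is allowed to be complex, these
  factors produce genuine poles, and poles coming from different vectors lie at different places.
  Hence the sum of the four functions could only vanish identically if the poles of \<open>i\<close> were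
  cancelled, and since \<open>\<D>\<^sup>k\<^sub>v\<close> is odd in \<open>v\<close> that would need \<open>- i\<close> among \<open>j, l, m\<close>. The definition
  of \<open>\<C>\<^sub>N\<close> together with \<open>i + j + l + m = 0\<close> excludes exactly this. A nonzero rational function of
  bounded degree cannot vanish at as many lattice points as the box contains.

  Three points turn this into a proof. Splitting each \<open>\<D>\<^sup>k\<^sub>v\<close> into its two halves
  (\<open>DD_eq_pole_terms\<close>) writes the sum as \<open>\<Sum>u. w\<^sub>u g\<^sub>u(k)\<close> over those \<open>u\<close> in
  \<open>U = {\<plusminus>i, \<plusminus>j, \<plusminus>l, \<plusminus>m}\<close> with \<open>k - u\<close> in the box, where the weight \<open>w\<^sub>u\<close> counts \<open>- u\<close> minus \<open>u\<close>
  among the four vectors, and \<open>g\<^sub>u\<close> has poles only at the complex zeros of \<open>|k|\<^sub>r\<^sup>2\<close>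
  and \<open>|k - u|\<^sub>r\<^sup>2\<close>.

  Next, \<open>k\<close> is restricted to a horizontal line \<open>k = (t, s)\<close> with \<open>s\<close> a suitable integer. After
  multiplication by the common denominator the sum over a fixed set of active \<open>u\<close> becomes a
  polynomial in \<open>t\<close> of degree at most \<open>2 |U| + 4 \<le> 20\<close> (\<open>degree_cleared_term\<close>). At the complex number
  \<open>t = a\<^sub>1 + \<i> r (s - a\<^sub>2)\<close>, where \<open>|k - a|\<^sub>r\<^sup>2\<close> vanishes, only the summand of \<open>a\<close> survives, so the
  polynomial is nonzero as soon as \<open>a\<close> is active and \<open>w\<^sub>a \<noteq> 0\<close> (\<open>cleared_sum_nonzero\<close>).

  Finally, the set of active \<open>u\<close> depends on \<open>t\<close>. For \<open>0 \<le> t \<le> N\<close> only vectors \<open>u\<close> with \<open>u\<^sub>1 < 0\<close> can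
  switch between active and inactive; there are at most four of them in \<open>U\<close>, so at most \<open>2\<^sup>4\<close>
  polynomials occur. Together they have at most \<open>16 \<cdot> 20 = 320\<close> roots, fewer than the \<open>N + 1\<close>
  available values of \<open>t\<close> (\<open>exists_nonzero_truncated_sum\<close>).
\<close>

section \<open>Splitting the coefficients into terms with separate poles\<close>

lemma minus_mem_lattice_box [simp]: "- k \<in> lattice_box N \<longleftrightarrow> k \<in> lattice_box N"
  by (auto simp: lattice_box_def)

lemma rnorm_sq_minus [simp]: "rnorm_sq r (- k) = rnorm_sq r k"
  by (simp add: rnorm_sq_def)

lemma rnorm_sq_pos:
  assumes "r > 0" "k \<noteq> 0"
  shows "rnorm_sq r k > 0"
proof (cases "fst k = 0")
  case True
  with assms have "snd k \<noteq> 0" by (auto simp: prod_eq_iff)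
  with True assms show ?thesis by (simp add: rnorm_sq_def)
next
  case False
  then show ?thesis by (simp add: rnorm_sq_def add_pos_nonneg)
qed

text \<open>
  The function \<open>g\<^sub>u(k)\<close>. For \<open>k\<close> near a generic complex zero of \<open>|k - u|\<^sub>r\<^sup>2\<close> it is the only one among all
  \<open>g\<^sub>v\<close> to blow up, which is what singles out one vector in the sum.
\<close>

definition pole_term :: "real \<Rightarrow> int \<times> int \<Rightarrow> int \<times> int \<Rightarrow> real" where
  "pole_term r k u = (rperp r u k)\<^sup>2 * (1 / rnorm_sq r k - 1 / rnorm_sq r u)
                      * (1 / rnorm_sq r k - 1 / rnorm_sq r (k - u))"

text \<open>
  Adding a multiple of \<open>k\<close> to \<open>v\<close> does not change the pairing with \<open>k\<close>, so both factors of each product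
  carry the same pairing up to sign. The half shifted by \<open>+ k\<close> is the term of the vector \<open>- v\<close>.
\<close>

lemma DD_eq_pole_terms:
  "DD r N k v = (if k + v \<in> lattice_box N then pole_term r k (- v) else 0)
              - (if k - v \<in> lattice_box N then pole_term r k v else 0)"
proof -
  have perp: "rperp r (v + k) k = rperp r v k" "rperp r (v - k) k = rperp r v k"
    "rperp r (- v) k = - rperp r v k"
    by (simp_all add: rperp_def algebra_simps)
  have "v - k = - (k - v)" by simp
  then have flip: "v - k \<in> lattice_box N \<longleftrightarrow> k - v \<in> lattice_box N"
    "rnorm_sq r (v - k) = rnorm_sq r (k - v)"
    by (metis minus_mem_lattice_box, metis rnorm_sq_minus)
  have plus: "coef r v k * coef r (v + k) k = pole_term r k (- v)"
    by (simp add: coef_def pole_term_def perp power2_eq_square add.commute[of k v])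
  have minus: "coef r v k * coef r (v - k) k = pole_term r k v"
    by (simp add: coef_def pole_term_def perp flip power2_eq_square)
  show ?thesis
    unfolding DD_def plus minus flip(1) by (simp add: add.commute)
qed

section \<open>The restriction to a horizontal line as a polynomial\<close>

text \<open>
  \<open>|k - u|\<^sub>r\<^sup>2\<close> for \<open>k = (t, s)\<close> as a polynomial in \<open>t\<close>. The coefficients are taken in \<open>\<complex>\<close> because
  the polynomial will be evaluated at its nonreal roots. The case \<open>u = 0\<close> is \<open>|k|\<^sub>r\<^sup>2\<close>.
\<close>

definition line_sqdist :: "real \<Rightarrow> int \<Rightarrow> int \<times> int \<Rightarrow> complex poly" where
  "line_sqdist r s u = [:- of_int (fst u), 1:]\<^sup>2 + [:of_real (r\<^sup>2 * (of_int (s - snd u))\<^sup>2):]"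

definition line_perp :: "real \<Rightarrow> int \<Rightarrow> int \<times> int \<Rightarrow> complex poly" where
  "line_perp r s u = [:- of_real (r * of_int (fst u * s)), of_real (r * of_int (snd u)):]"

text \<open>
  The term \<open>g\<^sub>u\<close> multiplied by the common denominator \<open>|k|\<^sub>r\<^sup>4 \<Prod>v\<in>U. |k - v|\<^sub>r\<^sup>2\<close>. The factors \<open>|k|\<^sub>r\<^sup>4\<close> and
  \<open>|k - u|\<^sub>r\<^sup>2\<close> are absorbed by the two differences of reciprocals.
\<close>

definition cleared_term :: "real \<Rightarrow> int \<Rightarrow> (int \<times> int) set \<Rightarrow> int \<times> int \<Rightarrow> complex poly" where
  "cleared_term r s U u =
     (line_perp r s u)\<^sup>2 * (1 - smult (of_real (1 / rnorm_sq r u)) (line_sqdist r s 0))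
     * (line_sqdist r s u - line_sqdist r s 0) * (\<Prod>v\<in>U - {u}. line_sqdist r s v)"

lemma poly_line_sqdist_of_int:
  "poly (line_sqdist r s u) (of_int t) = of_real (rnorm_sq r ((t, s) - u))"
  by (simp add: line_sqdist_def rnorm_sq_def power2_eq_square algebra_simps)

lemma poly_line_perp_of_int: "poly (line_perp r s u) (of_int t) = of_real (rperp r u (t, s))"
  by (simp add: line_perp_def rperp_def algebra_simps)

lemma poly_cleared_term_of_int:
  assumes "r > 0" "finite U" "u \<in> U" "0 \<notin> U" and off: "\<And>v. v \<in> insert 0 U \<Longrightarrow> (t, s) \<noteq> v"
  shows "poly (cleared_term r s U u) (of_int t)
         = of_real ((rnorm_sq r (t, s))\<^sup>2 * (\<Prod>v\<in>U. rnorm_sq r ((t, s) - v)) * pole_term r (t, s) u)"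
proof -
  define k where "k = (t, s)"
  have "k \<noteq> 0" "k - u \<noteq> 0" "u \<noteq> 0"
    using off[of 0] off[of u] assms(3,4) by (simp_all add: k_def, blast)
  then have nz: "rnorm_sq r k \<noteq> 0" "rnorm_sq r u \<noteq> 0" "rnorm_sq r (k - u) \<noteq> 0"
    by (metis less_irrefl rnorm_sq_pos[OF assms(1)])+
  have split: "(\<Prod>v\<in>U. rnorm_sq r (k - v)) = rnorm_sq r (k - u) * (\<Prod>v\<in>U - {u}. rnorm_sq r (k - v))"
    using assms by (simp add: prod.remove)
  have "poly (cleared_term r s U u) (of_int t)
      = of_real ((rperp r u k)\<^sup>2 * (1 - 1 / rnorm_sq r u * rnorm_sq r k)
          * (rnorm_sq r (k - u) - rnorm_sq r k) * (\<Prod>v\<in>U - {u}. rnorm_sq r (k - v)))"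
    by (simp add: cleared_term_def poly_line_sqdist_of_int poly_line_perp_of_int poly_prod k_def)
  also have "(rperp r u k)\<^sup>2 * (1 - 1 / rnorm_sq r u * rnorm_sq r k)
          * (rnorm_sq r (k - u) - rnorm_sq r k) * (\<Prod>v\<in>U - {u}. rnorm_sq r (k - v))
      = (rnorm_sq r k)\<^sup>2 * (\<Prod>v\<in>U. rnorm_sq r (k - v)) * pole_term r k u"
    unfolding split pole_term_def using nz by (simp add: field_simps power2_eq_square)
  finally show ?thesis by (simp add: k_def)
qed

lemma degree_line_sqdist: "degree (line_sqdist r s u) \<le> 2"
  unfolding line_sqdist_def
  by (intro degree_add_le order.trans[OF degree_power_le]) simp_all

lemma degree_cleared_term:
  assumes "finite U" "u \<in> U"
  shows "degree (cleared_term r s U u) \<le> 2 * card U + 4"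
proof -
  have "degree ((line_perp r s u)\<^sup>2) \<le> 2"
    by (rule order.trans[OF degree_power_le]) (simp add: line_perp_def)
  moreover have "degree (1 - smult (of_real (1 / rnorm_sq r u)) (line_sqdist r s 0)) \<le> 2"
    by (intro degree_diff_le order.trans[OF degree_smult_le] degree_line_sqdist) simp
  moreover have "degree (line_sqdist r s u - line_sqdist r s 0) \<le> 2"
    by (intro degree_diff_le degree_line_sqdist)
  moreover have "degree (\<Prod>v\<in>U - {u}. line_sqdist r s v) \<le> 2 * (card U - 1)"
  proof -
    have "degree (\<Prod>v\<in>U - {u}. line_sqdist r s v) \<le> (\<Sum>v\<in>U - {u}. degree (line_sqdist r s v))"
      using degree_prod_sum_le[of "U - {u}" "line_sqdist r s"] assms by (simp add: o_def)
    also have "\<dots> \<le> (\<Sum>v\<in>U - {u}. 2)"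
      by (intro sum_mono degree_line_sqdist)
    finally show ?thesis using assms by simp
  qed
  ultimately have "degree (cleared_term r s U u) \<le> 2 + 2 + 2 + 2 * (card U - 1)"
    unfolding cleared_term_def by (meson add_mono degree_mult_le order.trans)
  moreover have "card U > 0" using assms card_gt_0_iff by blast
  ultimately show ?thesis by simp
qed

section \<open>Evaluation at a complex pole\<close>

text \<open>
  A complex root of \<open>t \<mapsto> |(t, s) - a|\<^sub>r\<^sup>2\<close>: the vector \<open>(t, s) - a\<close> is isotropic there.
\<close>

definition iso_point :: "real \<Rightarrow> int \<Rightarrow> int \<times> int \<Rightarrow> complex" where
  "iso_point r s a = Complex (of_int (fst a)) (r * of_int (s - snd a))"

lemma poly_line_sqdist_iso_point:
  "poly (line_sqdist r s v) (iso_point r s a)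
   = Complex ((of_int (fst a - fst v))\<^sup>2 + r\<^sup>2 * ((of_int (s - snd v))\<^sup>2 - (of_int (s - snd a))\<^sup>2))
             (2 * r * of_int (fst a - fst v) * of_int (s - snd a))"
  by (simp add: line_sqdist_def iso_point_def complex_eq_iff power2_eq_square algebra_simps)

text \<open>
  The roots for \<open>a\<close> and \<open>v\<close> are \<open>a\<^sub>1 \<plusminus> \<i> r (s - a\<^sub>2)\<close> and \<open>v\<^sub>1 \<plusminus> \<i> r (s - v\<^sub>2)\<close>. For \<open>a \<noteq> v\<close> a common
  root forces \<open>s - v\<^sub>2 = - (s - a\<^sub>2)\<close>, and this is the coincidence that the choice of \<open>s\<close> avoids.
\<close>

lemma poly_line_sqdist_iso_point_eq_0:
  assumes "r > 0" "s \<noteq> snd a" "2 * s \<noteq> snd a + snd v"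
  shows "poly (line_sqdist r s v) (iso_point r s a) = 0 \<longleftrightarrow> v = a"
proof
  assume zero: "poly (line_sqdist r s v) (iso_point r s a) = 0"
  with assms have fst: "fst a = fst v"
    by (simp add: poly_line_sqdist_iso_point complex_eq_iff)
  with zero assms have "(of_int (s - snd v))\<^sup>2 = (of_int (s - snd a) :: real)\<^sup>2"
    by (simp add: poly_line_sqdist_iso_point complex_eq_iff)
  then have "s - snd v = s - snd a \<or> s - snd v = - (s - snd a)"
    by (metis of_int_eq_iff of_int_minus power2_eq_iff)
  with assms have "snd v = snd a" by auto
  with fst show "v = a" by (simp add: prod_eq_iff)
qed (simp add: poly_line_sqdist_iso_point complex_eq_iff)

text \<open>
  The next two lemmas show that the numerator of \<open>g\<^sub>a\<close> does not cancel the pole. At the isotropic point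
  \<open>k - a = (s - a\<^sub>2) (\<i> r, 1)\<close>, hence the pairing of \<open>a\<close> with \<open>k\<close> equals \<open>r (s - a\<^sub>2) (\<i> r a\<^sub>2 - a\<^sub>1)\<close>, and
  \<open>|k|\<^sub>r\<^sup>2 - |a|\<^sub>r\<^sup>2 = 2 r (s - a\<^sub>2) (\<i> a\<^sub>1 + r a\<^sub>2)\<close>. Neither vanishes because \<open>a\<close> is real and nonzero.
\<close>

lemma poly_line_perp_iso_point:
  assumes "r > 0" "a \<noteq> 0" "s \<noteq> snd a"
  shows "poly (line_perp r s a) (iso_point r s a) \<noteq> 0"
proof
  assume zero: "poly (line_perp r s a) (iso_point r s a) = 0"
  have "poly (line_perp r s a) (iso_point r s a)
      = Complex (r * of_int (fst a) * of_int (snd a - s)) (r\<^sup>2 * of_int (snd a) * of_int (s - snd a))"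
    by (simp add: line_perp_def iso_point_def complex_eq_iff power2_eq_square algebra_simps)
  with zero assms show False
    by (auto simp: complex_eq_iff prod_eq_iff)
qed

lemma line_sqdist_0_iso_point:
  assumes "r > 0" "a \<noteq> 0" "s \<noteq> snd a"
  shows "poly (line_sqdist r s 0) (iso_point r s a) \<noteq> of_real (rnorm_sq r a)"
proof
  assume eq: "poly (line_sqdist r s 0) (iso_point r s a) = of_real (rnorm_sq r a)"
  then have fst: "fst a = 0"
    using assms by (simp add: poly_line_sqdist_iso_point complex_eq_iff)
  with eq have "r\<^sup>2 * ((of_int s)\<^sup>2 - (of_int (s - snd a))\<^sup>2 - (of_int (snd a))\<^sup>2) = 0"
    by (simp add: poly_line_sqdist_iso_point complex_eq_iff rnorm_sq_def algebra_simps)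
  then have "of_int (snd a) * (of_int s - of_int (snd a)) = (0::real)"
    using assms by (simp add: power2_eq_square algebra_simps)
  with fst assms show False by (auto simp: prod_eq_iff)
qed

text \<open>
  Every cleared term with \<open>u \<noteq> a\<close> keeps the factor \<open>|k - a|\<^sub>r\<^sup>2\<close> and so vanishes at the isotropic point of
  \<open>a\<close>, while the cleared term of \<open>a\<close> is a product of nonzero numbers there. The index \<open>v = 0\<close> in the last
  hypothesis keeps that point away from the zeros of \<open>|k|\<^sub>r\<^sup>2\<close>.
\<close>

lemma cleared_sum_nonzero:
  fixes w :: "int \<times> int \<Rightarrow> real"
  assumes "r > 0" "finite U" "0 \<notin> U" "a \<in> X" "X \<subseteq> U" "w a \<noteq> 0"
    and off: "s \<noteq> snd a" "\<And>v. v \<in> insert 0 U \<Longrightarrow> 2 * s \<noteq> snd a + snd v"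
  shows "(\<Sum>u\<in>X. smult (of_real (w u)) (cleared_term r s U u)) \<noteq> 0" (is "?P \<noteq> 0")
proof -
  define z where "z = iso_point r s a"
  have a: "a \<in> U" "a \<noteq> 0" and X: "finite X"
    using assms finite_subset by auto
  have vanish: "poly (line_sqdist r s v) z = 0 \<longleftrightarrow> v = a" if "v \<in> insert 0 U" for v
    unfolding z_def using poly_line_sqdist_iso_point_eq_0 assms that by blast
  have "poly (cleared_term r s U u) z = 0" if "u \<in> X - {a}" for u
    using that a assms vanish by (auto simp: cleared_term_def poly_prod)
  then have "poly ?P z = of_real (w a) * poly (cleared_term r s U a) z"
    using X \<open>a \<in> X\<close> by (simp add: poly_sum sum.remove)
  moreover have "poly (cleared_term r s U a) z \<noteq> 0"
  proof -
    have "rnorm_sq r a \<noteq> 0" using rnorm_sq_pos[OF assms(1) a(2)] by simp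
    then have "1 - of_real (1 / rnorm_sq r a) * poly (line_sqdist r s 0) z \<noteq> 0"
      using line_sqdist_0_iso_point[of r a s] a assms by (auto simp: z_def field_simps)
    moreover have "poly (line_sqdist r s a) z - poly (line_sqdist r s 0) z \<noteq> 0"
      using vanish[of a] vanish[of 0] a by auto
    moreover have "(\<Prod>v\<in>U - {a}. poly (line_sqdist r s v) z) \<noteq> 0"
      using vanish assms by auto
    moreover have "poly (line_perp r s a) z \<noteq> 0"
      using poly_line_perp_iso_point a assms by (simp add: z_def)
    ultimately show ?thesis by (simp add: cleared_term_def poly_prod)
  qed
  ultimately have "poly ?P z \<noteq> 0" using assms by simp
  then show ?thesis by auto
qed

section \<open>Counting roots\<close>

text \<open>
  One of the intervals \<open>[0, N]\<close> and \<open>[-N, 0]\<close>, chosen by the sign of \<open>c\<close>, lies within distance \<open>N\<close> of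
  \<open>c\<close>, and it has more elements than \<open>B\<close>.
\<close>

lemma int_avoiding_finite_set:
  fixes c N :: int
  assumes "finite B" "int (card B) \<le> N" "\<bar>c\<bar> \<le> N"
  obtains s where "\<bar>s\<bar> \<le> N" "\<bar>s - c\<bar> \<le> N" "s \<notin> B"
proof -
  define S where "S = (if c \<ge> 0 then {0..N} else {-N..0})"
  have "card S = nat (N + 1)" by (simp add: S_def)
  then have "\<not> S \<subseteq> B" using card_mono[OF \<open>finite B\<close>, of S] assms by linarith
  then obtain s where "s \<in> S" "s \<notin> B" by auto
  with assms show thesis by (intro that) (auto simp: S_def split: if_splits)
qed

text \<open>
  The numerical hypotheses are what the count needs: the first leaves room for a height \<open>s\<close> that avoids
  all coincidences, and the second bounds the number of roots of all polynomials that occur along the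
  line. The condition \<open>fst a \<ge> 0\<close> makes \<open>a\<close> active for every \<open>t\<close> between \<open>0\<close> and \<open>N\<close>
  once \<open>s\<close> is within distance \<open>N\<close> of \<open>a\<^sub>2\<close>.
\<close>

lemma exists_nonzero_truncated_sum:
  fixes w :: "int \<times> int \<Rightarrow> real"
  assumes r: "r > 0" and U: "finite U" "U \<subseteq> lattice_box N"
    and a: "a \<in> U" "fst a \<ge> 0" "w a \<noteq> 0"
    and N: "2 * (int (card U) + 1) \<le> N"
      "2 ^ card {u \<in> U. fst u < 0} * (2 * int (card U) + 4) \<le> N"
  shows "\<exists>k\<in>lattice_box N. (\<Sum>u | u \<in> U \<and> k - u \<in> lattice_box N. w u * pole_term r k u) \<noteq> 0"
proof (rule ccontr)
  assume "\<not> ?thesis"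
  then have all_zero:
    "(\<Sum>u | u \<in> U \<and> k - u \<in> lattice_box N. w u * pole_term r k u) = 0"
    if "k \<in> lattice_box N" for k using that by blast
  have U0: "0 \<notin> U" and bound: "\<And>u. u \<in> U \<Longrightarrow> \<bar>fst u\<bar> \<le> N \<and> \<bar>snd u\<bar> \<le> N"
    using U by (auto simp: lattice_box_def)
  \<comment> \<open>Heights at which \<open>(t, s)\<close> could hit \<open>0\<close> or a vector of \<open>U\<close>, or at which two complex poles could
    coincide. The division truncates for odd sums, which only enlarges the set.\<close>
  define B where "B = snd ` insert 0 U \<union> (\<lambda>v. (snd a + snd v) div 2) ` insert 0 U"
  have "card B \<le> card (insert 0 U) + card (insert 0 U)"
    unfolding B_def using U by (intro order.trans[OF card_Un_le] add_mono card_image_le) auto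
  then have "int (card B) \<le> N" using U U0 N by simp
  then obtain s where s: "\<bar>s\<bar> \<le> N" "\<bar>s - snd a\<bar> \<le> N" "s \<notin> B"
    using int_avoiding_finite_set[of B N "snd a"] U bound[OF a(1)] by (auto simp: B_def)
  have off: "s \<noteq> snd v" "2 * s \<noteq> snd a + snd v" if "v \<in> insert 0 U" for v
  proof -
    show "s \<noteq> snd v" using s(3) that by (auto simp: B_def)
    have "s \<noteq> (snd a + snd v) div 2" using s(3) that by (auto simp: B_def)
    then show "2 * s \<noteq> snd a + snd v" by auto
  qed

  \<comment> \<open>For \<open>0 \<le> t \<le> N\<close> a vector \<open>u\<close> with \<open>u\<^sub>1 \<ge> 0\<close> satisfies \<open>\<bar>t - u\<^sub>1\<bar> \<le> N\<close>, so whether it is active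
    is decided by \<open>s\<close> alone.\<close>
  define act where "act t = {u \<in> U. (t, s) - u \<in> lattice_box N}" for t
  define Neg where "Neg = {u \<in> U. fst u < 0}"
  define Fixed where "Fixed = {u \<in> U. fst u \<ge> 0 \<and> \<bar>s - snd u\<bar> \<le> N}"
  define P where "P X = (\<Sum>u\<in>X. smult (of_real (w u)) (cleared_term r s U u))" for X
  have act_iff: "u \<in> act t \<longleftrightarrow> u \<in> U \<and> \<bar>t - fst u\<bar> \<le> N \<and> \<bar>s - snd u\<bar> \<le> N" for t u
    using off(1)[of u] by (auto simp: act_def lattice_box_def prod_eq_iff)
  have act: "\<exists>Y\<in>Pow Neg. act t = Fixed \<union> Y" if "t \<in> {0..N}" for t
    using that bound
    by (intro bexI[of _ "act t \<inter> Neg"]) (fastforce simp: act_iff Neg_def Fixed_def)+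
  have aF: "a \<in> Fixed" using a s by (simp add: Fixed_def)

  \<comment> \<open>One polynomial for each conceivable active set \<open>Fixed \<union> Y\<close>; all of them contain \<open>a\<close>.\<close>
  have roots: "finite {z. poly (P (Fixed \<union> Y)) z = 0}"
    "card {z. poly (P (Fixed \<union> Y)) z = 0} \<le> 2 * card U + 4" if "Y \<in> Pow Neg" for Y
  proof -
    have sub: "Fixed \<union> Y \<subseteq> U" using that by (auto simp: Fixed_def Neg_def)
    have nz: "P (Fixed \<union> Y) \<noteq> 0"
      unfolding P_def
      by (rule cleared_sum_nonzero[where w = w and a = a, OF r U(1) U0 _ sub a(3) off(1)])
        (simp add: aF, simp add: a, rule off(2))
    have "degree (P (Fixed \<union> Y)) \<le> 2 * card U + 4"
      unfolding P_def using U sub finite_subset[OF sub]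
      by (intro degree_sum_le order.trans[OF degree_smult_le] degree_cleared_term) auto
    then show "card {z. poly (P (Fixed \<union> Y)) z = 0} \<le> 2 * card U + 4"
      using card_poly_roots_bound[OF nz] by linarith
    show "finite {z. poly (P (Fixed \<union> Y)) z = 0}" by (rule poly_roots_finite[OF nz])
  qed

  have zero: "poly (P (act t)) (of_int t) = 0" if "t \<in> {0..N}" for t
  proof -
    have kbox: "(t, s) \<in> lattice_box N"
      using that s off(1)[of 0] by (auto simp: lattice_box_def prod_eq_iff)
    have ne: "(t, s) \<noteq> v" if "v \<in> insert 0 U" for v using off(1)[OF that] by auto
    define c where "c = (rnorm_sq r (t, s))\<^sup>2 * (\<Prod>v\<in>U. rnorm_sq r ((t, s) - v))"
    have "poly (P (act t)) (of_int t)
        = (\<Sum>u\<in>act t. of_real (w u) * of_real (c * pole_term r (t, s) u))"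
      unfolding P_def poly_sum poly_smult c_def
      by (intro sum.cong refl arg_cong2[where f = "(*)"] poly_cleared_term_of_int ne)
        (use r U U0 in \<open>auto simp: act_def\<close>)
    also have "\<dots> = of_real (c * (\<Sum>u\<in>act t. w u * pole_term r (t, s) u))"
      by (simp add: sum_distrib_left mult_ac)
    also have "(\<Sum>u\<in>act t. w u * pole_term r (t, s) u) = 0"
      using all_zero[OF kbox] by (simp add: act_def)
    finally show ?thesis by simp
  qed

  \<comment> \<open>Each of the \<open>N + 1\<close> integers \<open>t\<close> is a root of the polynomial of its own active set.\<close>
  have fin: "finite (Pow Neg)" using U by (simp add: Neg_def)
  have "of_int ` {0..N} \<subseteq> (\<Union>Y\<in>Pow Neg. {z. poly (P (Fixed \<union> Y)) z = 0})"
    using zero act by fastforce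
  then have "card (of_int ` {0..N} :: complex set)
      \<le> card (\<Union>Y\<in>Pow Neg. {z. poly (P (Fixed \<union> Y)) z = 0})"
    using fin roots by (intro card_mono) auto
  also have "\<dots> \<le> (\<Sum>Y\<in>Pow Neg. card {z. poly (P (Fixed \<union> Y)) z = 0})"
    by (rule card_UN_le[OF fin])
  also have "\<dots> \<le> card (Pow Neg) * (2 * card U + 4)"
    using sum_bounded_above[of "Pow Neg", OF roots(2)] by simp
  also have "\<dots> = 2 ^ card Neg * (2 * card U + 4)"
    using U by (simp add: Neg_def card_Pow)
  finally have "nat (N + 1) \<le> 2 ^ card Neg * (2 * card U + 4)"
    by (simp add: card_image inj_on_def)
  then have "N + 1 \<le> int (2 ^ card Neg * (2 * card U + 4))" by linarith
  with N(2) show False by (simp add: Neg_def)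
qed

section \<open>Four vectors with sum zero\<close>

theorem proposition5p1:
  fixes N :: int and r :: real and i j l m :: "int \<times> int"
  assumes "N \<ge> 392"
    and "r > 0"
    and "(i, j, l, m) \<in> CC N"
    and "i + j + l + m = 0"
  shows "\<exists>k \<in> lattice_box N. DD r N k i + DD r N k j + DD r N k l + DD r N k m \<noteq> 0"
proof -
  define V where "V = [i, j, l, m]"
  define U where "U = set V \<union> uminus ` set V"
  define w :: "int \<times> int \<Rightarrow> real"
    where "w u = (\<Sum>v\<leftarrow>V. of_bool (u = - v) - of_bool (u = v))" for u
  have box: "set V \<subseteq> lattice_box N" using assms(3) by (auto simp: V_def CC_def)
  then have Ubox: "U \<subseteq> lattice_box N"
    unfolding U_def by (intro Un_least image_subsetI) (simp_all add: subsetD)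
  have finU: "finite U" by (simp add: U_def)
  have "card U \<le> card (set V) + card (set V)"
    unfolding U_def by (intro order.trans[OF card_Un_le] add_mono card_image_le) auto
  also have "\<dots> \<le> 4 + 4"
    using card_length[of V] by (intro add_mono) (simp_all add: V_def)
  finally have cardU: "card U \<le> 8" by simp
  \<comment> \<open>Of \<open>v\<close> and \<open>- v\<close> at most one has a negative first coordinate.\<close>
  have "{u \<in> U. fst u < 0} \<subseteq> set (map (\<lambda>v. if fst v < 0 then v else - v) V)"
    by (force simp: U_def)
  then have "card {u \<in> U. fst u < 0} \<le> card (set (map (\<lambda>v. if fst v < 0 then v else - v) V))"
    by (intro card_mono) auto
  also have "\<dots> \<le> 4"
    by (rule order.trans[OF card_length]) (simp add: V_def)
  finally have cardNeg: "card {u \<in> U. fst u < 0} \<le> 4" .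
  have "(2::int) ^ card {u \<in> U. fst u < 0} * (2 * int (card U) + 4) \<le> 2 ^ 4 * (2 * 8 + 4)"
    using cardU cardNeg by (intro mult_mono power_increasing) auto
  then have N: "2 ^ card {u \<in> U. fst u < 0} * (2 * int (card U) + 4) \<le> N"
    "2 * (int (card U) + 1) \<le> N"
    using assms(1) cardU by auto

  \<comment> \<open>As the total is zero, one vanishing pair sum makes the complementary pair sum vanish as well.\<close>
  have nopair: "i \<noteq> - v" if "v \<in> set V" for v
  proof
    assume "i = - v"
    have "i \<noteq> 0" using box by (auto simp: V_def lattice_box_def)
    with \<open>i = - v\<close> have "v \<noteq> i" by (auto simp: prod_eq_iff)
    with that have "v = j \<or> v = l \<or> v = m" by (auto simp: V_def)
    moreover have "\<not> (i + j = 0 \<and> l + m = 0)" "\<not> (i + l = 0 \<and> j + m = 0)" "\<not> (i + m = 0 \<and> j + l = 0)"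
      using assms(3) by (simp_all add: CC_def)
    moreover have "(i + j) + (l + m) = 0" "(i + l) + (j + m) = 0" "(i + m) + (j + l) = 0"
      using assms(4) by (simp_all add: add_ac)
    moreover have "i + v = 0" using \<open>i = - v\<close> by simp
    ultimately show False by auto
  qed
  \<comment> \<open>With no \<open>- i\<close> present, the weight of \<open>i\<close> is minus its multiplicity.\<close>
  have wi: "w i \<noteq> 0"
    using nopair by (simp add: w_def V_def)
  have wneg: "w (- u) = - w u" for u
  proof -
    have flip: "- u = v \<longleftrightarrow> u = - v" for v :: "int \<times> int"
      by (metis minus_minus)
    show ?thesis by (simp add: w_def V_def flip)
  qed
  obtain a where a: "a \<in> U" "fst a \<ge> 0" "w a \<noteq> 0"
  proof (cases "fst i \<ge> 0")
    case True
    then show ?thesis using that[of i] wi by (simp add: U_def V_def)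
  next
    case False
    then show ?thesis using that[of "- i"] wi wneg[of i] by (simp add: U_def V_def)
  qed

  have sum: "(\<Sum>u | u \<in> U \<and> k - u \<in> lattice_box N. w u * pole_term r k u)
      = DD r N k i + DD r N k j + DD r N k l + DD r N k m" for k
  proof -
    define h where "h u = (if k - u \<in> lattice_box N then pole_term r k u else 0)" for u
    have one: "(\<Sum>u\<in>U. (of_bool (u = - v) - of_bool (u = v)) * h u) = DD r N k v"
      if "v \<in> set V" for v
    proof -
      have "v \<in> U" "- v \<in> U" using that by (auto simp: U_def)
      then show ?thesis
        using finU by (simp add: left_diff_distrib sum_subtractf of_bool_def if_distrib[of "\<lambda>x. x * _"]
            sum.delta sum.delta' DD_eq_pole_terms h_def cong: if_cong)
    qed
    have "(\<Sum>u | u \<in> U \<and> k - u \<in> lattice_box N. w u * pole_term r k u) = (\<Sum>u\<in>U. w u * h u)"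
      using finU by (intro sum.mono_neutral_cong_left) (auto simp: h_def)
    also have "\<dots> = (\<Sum>v\<leftarrow>V. \<Sum>u\<in>U. (of_bool (u = - v) - of_bool (u = v)) * h u)"
      by (simp add: w_def V_def distrib_right sum.distrib)
    also have "\<dots> = (\<Sum>v\<leftarrow>V. DD r N k v)"
      by (intro arg_cong[where f = sum_list] map_cong refl one)
    finally show ?thesis by (simp add: V_def)
  qed
  show ?thesis
    using exists_nonzero_truncated_sum[where w = w, OF assms(2) finU Ubox a N(2,1)] unfolding sum .
qed

end
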